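(* Let $J_0$ be the Bessel function of the first kind of order $0$, and set $$k_a=\frac{2(\cos(1)-J_0(1))}{\cos(1)-\sin(1)},\qquad k_b=\frac{1-J_0(1)}{1-\sin(1)},\qquad k=\frac{k_a+k_b}{2},$$ $$C_1(x)=k\left(-\frac{\sin(\cos(x))}{\sin(x)}+\sin(1)\cot(x)\right)+J_0(1)\,x .$$ Then for all real numbers $l\le u$, $$\left|\int_l^u\cos(\cos(x))\,\mathrm{d}x-\bigl(C_1(u)-C_1(l)\bigr)\right|\le\left(\sqrt{2}\sin\left(\frac{\sqrt{2}}{2}\right)-\sin(1)\right)\left(k_a-k_b\right)\le 9.6\cdot 10^{-4}.$$
   Context: At the points $x\in\pi\mathbb{Z}$, where $\sin(x)=0$, the function $\tilde P(x)=-\frac{\sin(\cos(x))}{\sin(x)}+\sin(1)\cot(x)$ is understood through its limit, which exists and equals $0$; thus $C_1(n\pi)=J_0(1)\,n\pi$ for $n\in\mathbb{Z}$, and $C_1$ is defined on all of $\mathbb{R}$. *)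

theory Defs
  imports "HOL-Analysis.Analysis"
begin

text \<open>Bessel function of the first kind of order \<open>n\<close> (natural order, real argument),
  by its power series.\<close>

definition bessel_J :: "nat \<Rightarrow> real \<Rightarrow> real" where
  "bessel_J n x = (\<Sum>m. (- 1) ^ m / (fact m * fact (m + n)) * (x / 2) ^ (2 * m + n))"

definition k_a :: real where
  "k_a = 2 * (cos 1 - bessel_J 0 1) / (cos 1 - sin 1)"

definition k_b :: real where
  "k_b = (1 - bessel_J 0 1) / (1 - sin 1)"

definition k_avg :: real where
  "k_avg = (k_a + k_b) / 2"

text \<open>At the zeros of the sine the formula is read as its limit, which is 0 by
  \<open>P_tilde_limit\<close> below.\<close>

definition P_tilde :: "real \<Rightarrow> real" where
  "P_tilde x = (if sin x = 0 then 0 else - (sin (cos x) / sin x) + sin 1 * cot x)"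

definition C1 :: "real \<Rightarrow> real" where
  "C1 x = k_avg * P_tilde x + bessel_J 0 1 * x"

lemma P_tilde_limit:
  fixes x :: real
  assumes "sin x = 0"
  shows "((\<lambda>t. - (sin (cos t) / sin t) + sin 1 * cot t) \<longlongrightarrow> 0) (at x)"
proof -
  have c: "cos x = 1 \<or> cos x = - 1"
    using sin_cos_squared_add[of x] assms by (simp add: power2_eq_1_iff)
  define f where "f = (\<lambda>t::real. - sin (cos t) + sin 1 * cos t)"
  have fx: "f x = 0"
    using c by (auto simp: f_def)
  have "(f has_field_derivative 0) (at x)"
    unfolding f_def by (rule derivative_eq_intros refl | simp add: assms)+
  then have "((\<lambda>t. f t / (t - x)) \<longlongrightarrow> 0) (at x)"
    using fx by (simp add: has_field_derivative_iff)
  moreover have "((\<lambda>t. sin t / (t - x)) \<longlongrightarrow> cos x) (at x)"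
    using DERIV_sin[of x] assms by (simp add: has_field_derivative_iff)
  ultimately have "((\<lambda>t. (f t / (t - x)) / (sin t / (t - x))) \<longlongrightarrow> 0 / cos x) (at x)"
    using c by (intro tendsto_divide) auto
  moreover have "\<forall>\<^sub>F t in at x. (f t / (t - x)) / (sin t / (t - x))
      = - (sin (cos t) / sin t) + sin 1 * cot t"
    unfolding eventually_at_filter
    by (rule always_eventually) (auto simp: f_def cot_def diff_divide_distrib [symmetric])
  ultimately show ?thesis
    by (simp add: tendsto_cong)
qed

end

theory Submission
  imports Defs
begin

text \<open>Expand \<open>cos (cos x)\<close> and \<open>sin (cos x)\<close> in powers of \<open>cos x\<close> and integrate termwise. The
  secular parts of the antiderivatives of \<open>cos x ^ (2 * m)\<close> add up to \<open>J\<^sub>0(1) x\<close>, and what remains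
  of \<open>\<integral>cos (cos x) - C\<^sub>1\<close> is a series \<open>sin x cos x Q(cos\<^sup>2 x)\<close>, valid on all of the real line, with
  factorially small coefficients. After truncation \<open>Q\<close> is a cubic that is close to a multiple of
  \<open>y - 1/2\<close>, so that the error is essentially a small multiple of \<open>sin (4 * x)\<close>; its amplitude is
  about half of what the theorem allows.\<close>

section \<open>Factorially convergent series\<close>

text \<open>Each step in \<open>m\<close> multiplies the right side by two consecutive factors whose
  product is at least 2. Hence the tails of all series below are dominated by a geometric series of
  ratio 1/2.\<close>

lemma fact_double_add_ge: "fact (2 * N) * 2 ^ m \<le> (fact (2 * (m + N)) :: real)"
proof (induction m)
  case (Suc m)
  have "fact (2 * N) * 2 ^ Suc m \<le> 2 * (fact (2 * (m + N)) :: real)"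
    using Suc by simp
  also have "\<dots> \<le> (real (2 * (m + N)) + 2) * ((real (2 * (m + N)) + 1) * fact (2 * (m + N)))"
    by (intro mult_mono) (auto simp: mult_le_cancel_right1)
  also have "\<dots> = fact (2 * (Suc m + N))"
    by (simp add: algebra_simps)
  finally show ?case .
qed simp

lemma summable_inverse_fact_double: "summable (\<lambda>n. 1 / fact (2 * n) :: real)"
proof (rule summable_comparison_test'[OF summable_geometric[of "1/2 :: real"]])
  show "norm (1 / fact (2 * n) :: real) \<le> (1 / 2) ^ n" for n
    using fact_double_add_ge[of 0 n] by (simp add: field_simps)
qed simp

text \<open>The geometric majorant of the tail sums to twice its first term. This one truncation
  estimate serves both the numerical constants and the error series.\<close>

lemma series_tail_fact_double:
  fixes a :: "nat \<Rightarrow> real"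
  assumes "a sums S" and le: "\<And>n. \<bar>a n\<bar> \<le> 1 / fact (2 * n)"
  shows "\<bar>S - (\<Sum>n<N. a n)\<bar> \<le> 2 / fact (2 * N)"
proof -
  have tail: "(\<lambda>n. a (n + N)) sums (S - (\<Sum>n<N. a n))"
    using assms(1) by (simp add: sums_iff_shift)
  have "(\<lambda>n. 1 / fact (2 * N) * (1 / 2) ^ n :: real) sums (1 / fact (2 * N) * (1 / (1 - 1 / 2)))"
    by (intro sums_mult geometric_sums) simp
  then have g: "(\<lambda>n. 1 / fact (2 * N) * (1 / 2) ^ n :: real) sums (2 / fact (2 * N))"
    by simp
  have "norm (a (n + N)) \<le> 1 / fact (2 * N) * (1 / 2) ^ n" for n
  proof -
    have "norm (a (n + N)) \<le> 1 / fact (2 * (n + N))"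
      using le[of "n + N"] by simp
    also have "\<dots> \<le> 1 / (fact (2 * N) * 2 ^ n)"
      using fact_double_add_ge[of N n] by (intro divide_left_mono) auto
    finally show ?thesis by (simp add: power_divide)
  qed
  then have "norm (\<Sum>n. a (n + N)) \<le> (\<Sum>n. 1 / fact (2 * N) * (1 / 2) ^ n :: real)"
    using g by (intro norm_suminf_le) (auto simp: sums_iff)
  then show ?thesis
    using tail g by (auto simp: sums_iff)
qed

section \<open>Antiderivatives of even powers of the cosine\<close>

text \<open>The mean of \<open>cos x ^ (2 * m)\<close> over a period, by the Wallis
  recurrence.\<close>

primrec cos_mean :: "nat \<Rightarrow> real" where
  "cos_mean 0 = 1"
| "cos_mean (Suc m) = (2 * real m + 1) / (2 * real m + 2) * cos_mean m"

text \<open>The periodic part of the antiderivative of \<open>cos x ^ (2 * m)\<close>, normalised to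
  vanish at 0; the recurrence is the reduction formula from integration by parts.\<close>

primrec cos_osc :: "nat \<Rightarrow> real \<Rightarrow> real" where
  "cos_osc 0 x = 0"
| "cos_osc (Suc m) x =
     (2 * real m + 1) / (2 * real m + 2) * cos_osc m x + sin x * cos x ^ (2 * m + 1) / (2 * real m + 2)"

lemma cos_mean_eq: "cos_mean m = fact (2 * m) / (4 ^ m * (fact m)\<^sup>2)"
proof (induction m)
  case (Suc m)
  have "(2 * real m + 2) * (2 * real m + 1) / (4 * (real m + 1)\<^sup>2) = (2 * real m + 1) / (2 * real m + 2)"
    by (simp add: divide_simps) (simp add: power2_eq_square algebra_simps)
  moreover have "fact (2 * Suc m) / (4 ^ Suc m * (fact (Suc m))\<^sup>2)
      = (2 * real m + 2) * (2 * real m + 1) / (4 * (real m + 1)\<^sup>2) * (fact (2 * m) / (4 ^ m * (fact m)\<^sup>2))"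
    by (simp add: power_mult_distrib add_ac mult_ac)
  ultimately show ?case using Suc by simp
qed simp

lemma DERIV_cos_mean_osc:
  "((\<lambda>x. cos_mean m * x + cos_osc m x) has_field_derivative cos x ^ (2 * m)) (at x)"
proof (induction m)
  case 0
  show ?case by (auto intro!: derivative_eq_intros)
next
  case (Suc m)
  define p where "p = (2 * real m + 1) / (2 * real m + 2)"
  have s2: "(sin x)\<^sup>2 = 1 - (cos x)\<^sup>2"
    by (simp add: sin_squared_eq)
  have "((\<lambda>x. sin x * cos x ^ (2 * m + 1)) has_field_derivative
      cos x * cos x ^ (2 * m + 1) - (2 * real m + 1) * cos x ^ (2 * m) * (sin x)\<^sup>2) (at x)"
    using DERIV_mult[OF DERIV_sin DERIV_power_Suc[OF DERIV_cos[of x], of "2 * m"]]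
    by (simp add: power2_eq_square algebra_simps)
  also have "cos x * cos x ^ (2 * m + 1) - (2 * real m + 1) * cos x ^ (2 * m) * (sin x)\<^sup>2
      = (2 * real m + 2) * (cos x ^ (2 * Suc m) - p * cos x ^ (2 * m))"
    unfolding s2 p_def by (simp add: field_simps power2_eq_square)
  finally have "((\<lambda>x. p * (cos_mean m * x + cos_osc m x) + sin x * cos x ^ (2 * m + 1) / (2 * real m + 2))
      has_field_derivative p * cos x ^ (2 * m)
        + (2 * real m + 2) * (cos x ^ (2 * Suc m) - p * cos x ^ (2 * m)) / (2 * real m + 2)) (at x)"
    by (intro DERIV_add DERIV_cmult DERIV_cdivide Suc)
  moreover have "(\<lambda>x. p * (cos_mean m * x + cos_osc m x) + sin x * cos x ^ (2 * m + 1) / (2 * real m + 2))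
      = (\<lambda>x. cos_mean (Suc m) * x + cos_osc (Suc m) x)"
    by (auto simp: p_def distrib_left)
  ultimately show ?case by simp
qed

text \<open>The weights \<open>(2 * m + 1) / (2 * m + 2)\<close> and \<open>1 / (2 * m + 2)\<close>
  of the recurrence add up to 1, so the bound 1 reproduces itself.\<close>

lemma abs_cos_osc_le_1: "\<bar>cos_osc m x\<bar> \<le> 1"
proof (induction m)
  case (Suc m)
  have "\<bar>cos_osc (Suc m) x\<bar> \<le> (2 * real m + 1) / (2 * real m + 2) * \<bar>cos_osc m x\<bar>
      + \<bar>sin x\<bar> * \<bar>cos x\<bar> ^ (2 * m + 1) / (2 * real m + 2)"
    by (simp add: abs_mult power_abs order_trans[OF abs_triangle_ineq])
  also have "\<bar>sin x\<bar> * \<bar>cos x\<bar> ^ (2 * m + 1) \<le> 1 * 1"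
    by (intro mult_mono power_le_one) auto
  also have "(2 * real m + 1) / (2 * real m + 2) * \<bar>cos_osc m x\<bar> + 1 * 1 / (2 * real m + 2)
      \<le> (2 * real m + 1) / (2 * real m + 2) * 1 + 1 * 1 / (2 * real m + 2)"
    by (intro add_mono mult_left_mono Suc) auto
  also have "\<dots> = 1" by (simp add: field_simps)
  finally show ?case by (simp add: divide_right_mono)
qed simp

text \<open>By \<open>cos_mean_eq\<close> the factor \<open>fact (2 * m)\<close> cancels, which
  leaves the Bessel coefficient \<open>1 / (4 ^ m * (fact m)\<^sup>2)\<close> up to sign.\<close>

lemma bessel_J_0_1_sums: "(\<lambda>m. (- 1) ^ m / fact (2 * m) * cos_mean m) sums bessel_J 0 1"
  and bessel_J_0_1_term_le: "\<bar>(- 1) ^ m / fact (2 * m) * cos_mean m\<bar> \<le> 1 / fact (2 * m)"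
proof -
  have mean01: "0 \<le> cos_mean m \<and> cos_mean m \<le> 1" for m
  proof (induction m)
    case (Suc m)
    then have "(2 * real m + 1) / (2 * real m + 2) * cos_mean m \<le> 1 * 1"
      by (intro mult_mono) auto
    with Suc show ?case by simp
  qed simp
  then show le: "\<bar>(- 1) ^ m / fact (2 * m) * cos_mean m\<bar> \<le> 1 / fact (2 * m)" for m
    by (simp add: abs_mult divide_right_mono)
  have "summable (\<lambda>m. (- 1) ^ m / fact (2 * m) * cos_mean m)"
    using le by (intro summable_comparison_test'[OF summable_inverse_fact_double]) simp
  moreover have "(- 1) ^ m / fact (2 * m) * cos_mean m
      = (- 1) ^ m / (fact m * fact (m + 0)) * (1 / 2) ^ (2 * m + 0)" for m
    by (simp add: cos_mean_eq power_mult power_divide power2_eq_square)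
  ultimately show "(\<lambda>m. (- 1) ^ m / fact (2 * m) * cos_mean m) sums bessel_J 0 1"
    unfolding bessel_J_def by (simp add: summable_sums)
qed

section \<open>Series for the integral and for the approximant\<close>

text \<open>The Weierstrass test with majorant \<open>1 / fact (2 * m)\<close> makes the cosine
  series in \<open>cos x\<close> uniformly convergent, so that it may be integrated
  termwise.\<close>

lemma integral_cos_cos_sums:
  assumes "l \<le> u"
  shows "(\<lambda>m. (- 1) ^ m / fact (2 * m) * (cos_mean m * (u - l) + (cos_osc m u - cos_osc m l)))
           sums integral {l..u} (\<lambda>x. cos (cos x))"
proof -
  define t where "t m x = (- 1) ^ m / fact (2 * m) * cos x ^ (2 * m)" for m and x :: real
  have "norm (t m x) \<le> 1 / fact (2 * m)" for m x
    by (simp add: t_def abs_mult divide_right_mono power_abs power_le_one)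
  then have "uniform_limit {l..u} (\<lambda>n x. \<Sum>m<n. t m x) (\<lambda>x. \<Sum>m. t m x) sequentially"
    by (intro Weierstrass_m_test[OF _ summable_inverse_fact_double])
  moreover have "(\<Sum>m. t m x) = cos (cos x)" for x
    using cos_paired[of "cos x"] by (simp add: t_def sums_iff)
  ultimately have lim: "uniform_limit {l..u} (\<lambda>n x. \<Sum>m<n. t m x) (\<lambda>x. cos (cos x)) sequentially"
    by simp
  have cont: "continuous_on {l..u} (\<lambda>x. \<Sum>m<n. t m x)" for n
    unfolding t_def by (intro continuous_intros)
  obtain I J where I: "\<And>n. ((\<lambda>x. \<Sum>m<n. t m x) has_integral I n) {l..u}"
    and J: "((\<lambda>x. cos (cos x)) has_integral J) {l..u}" and IJ: "I \<longlonglongrightarrow> J"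
    using uniform_limit_integral[OF lim cont sequentially_bot] by metis
  have "(t m has_integral
      (- 1) ^ m / fact (2 * m) * (cos_mean m * (u - l) + (cos_osc m u - cos_osc m l))) {l..u}" for m
  proof -
    have "((\<lambda>x. cos x ^ (2 * m)) has_integral
        (cos_mean m * u + cos_osc m u) - (cos_mean m * l + cos_osc m l)) {l..u}"
      using assms DERIV_cos_mean_osc
      by (intro fundamental_theorem_of_calculus)
         (auto simp: has_real_derivative_iff_has_vector_derivative[symmetric]
               intro: has_field_derivative_at_within)
    from has_integral_mult_right[OF this, of "(- 1) ^ m / fact (2 * m)"]
    show ?thesis by (simp add: t_def[abs_def] algebra_simps)
  qed
  then have "((\<lambda>x. \<Sum>m<n. t m x) has_integral
      (\<Sum>m<n. (- 1) ^ m / fact (2 * m) * (cos_mean m * (u - l) + (cos_osc m u - cos_osc m l)))) {l..u}" for n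
    by (intro has_integral_sum) auto
  with I have "I = (\<lambda>n. \<Sum>m<n. (- 1) ^ m / fact (2 * m) * (cos_mean m * (u - l) + (cos_osc m u - cos_osc m l)))"
    by (blast intro: has_integral_unique)
  with IJ J show ?thesis
    by (simp add: sums_def integral_unique)
qed

lemma cos_osc_summable: "summable (\<lambda>m. (- 1) ^ m / fact (2 * m) * cos_osc m x)"
  and cos_osc_term_le: "\<bar>(- 1) ^ m / fact (2 * m) * cos_osc m x\<bar> \<le> 1 / fact (2 * m)"
proof -
  show le: "\<bar>(- 1) ^ m / fact (2 * m) * cos_osc m x\<bar> \<le> 1 / fact (2 * m)" for m
    using abs_cos_osc_le_1[of m x] by (simp add: abs_mult divide_right_mono)
  then show "summable (\<lambda>m. (- 1) ^ m / fact (2 * m) * cos_osc m x)"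
    by (intro summable_comparison_test'[OF summable_inverse_fact_double]) simp
qed

lemma integral_cos_cos_eq:
  assumes "l \<le> u"
  shows "integral {l..u} (\<lambda>x. cos (cos x)) = bessel_J 0 1 * (u - l)
    + ((\<Sum>m. (- 1) ^ m / fact (2 * m) * cos_osc m u) - (\<Sum>m. (- 1) ^ m / fact (2 * m) * cos_osc m l))"
proof -
  have "(\<lambda>m. (- 1) ^ m / fact (2 * m) * cos_mean m * (u - l)
      + ((- 1) ^ m / fact (2 * m) * cos_osc m u - (- 1) ^ m / fact (2 * m) * cos_osc m l))
    sums (bessel_J 0 1 * (u - l)
      + ((\<Sum>m. (- 1) ^ m / fact (2 * m) * cos_osc m u) - (\<Sum>m. (- 1) ^ m / fact (2 * m) * cos_osc m l)))"
    by (intro sums_add sums_diff sums_mult2 bessel_J_0_1_sums summable_sums cos_osc_summable)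
  also have "(\<lambda>m. (- 1) ^ m / fact (2 * m) * cos_mean m * (u - l)
      + ((- 1) ^ m / fact (2 * m) * cos_osc m u - (- 1) ^ m / fact (2 * m) * cos_osc m l))
    = (\<lambda>m. (- 1) ^ m / fact (2 * m) * (cos_mean m * (u - l) + (cos_osc m u - cos_osc m l)))"
    by (auto simp: distrib_left right_diff_distrib)
  finally show ?thesis
    using integral_cos_cos_sums[OF assms] sums_unique2 by blast
qed

text \<open>In the difference of the sine series for \<open>sin 1 * cos x\<close> and
  \<open>sin (cos x)\<close>, each term contains \<open>1 - cos x ^ (2 * m)\<close>, which is
  divisible by \<open>1 - (cos x)\<^sup>2 = (sin x)\<^sup>2\<close>. Division by
  \<open>sin x\<close> thus leaves a factor \<open>sin x\<close>, and at the zeros of the sine every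
  term vanishes, in agreement with the value 0 of \<open>P_tilde\<close>.\<close>

lemma P_tilde_sums:
  "(\<lambda>m. (- 1) ^ m / fact (2 * m + 1) * (sin x * cos x * (\<Sum>i<m. ((cos x)\<^sup>2) ^ i))) sums P_tilde x"
proof (cases "sin x = 0")
  case True
  then show ?thesis by (simp add: P_tilde_def)
next
  case False
  have "(\<lambda>m. ((- 1) ^ m / fact (2 * m + 1) * 1 ^ (2 * m + 1) * cos x
      - (- 1) ^ m / fact (2 * m + 1) * cos x ^ (2 * m + 1)) / sin x)
    sums ((sin 1 * cos x - sin (cos x)) / sin x)"
    by (intro sums_divide sums_diff sums_mult2 sin_paired)
  moreover have "(sin 1 * cos x - sin (cos x)) / sin x = P_tilde x"
    using False by (simp add: P_tilde_def cot_def diff_divide_distrib)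
  moreover have "((- 1) ^ m / fact (2 * m + 1) * 1 ^ (2 * m + 1) * cos x
      - (- 1) ^ m / fact (2 * m + 1) * cos x ^ (2 * m + 1)) / sin x
    = (- 1) ^ m / fact (2 * m + 1) * (sin x * cos x * (\<Sum>i<m. ((cos x)\<^sup>2) ^ i))" for m
  proof -
    have "1 - ((cos x)\<^sup>2) ^ m = (1 - (cos x)\<^sup>2) * (\<Sum>i<m. ((cos x)\<^sup>2) ^ i)"
      by (rule one_diff_power_eq)
    also have "1 - (cos x)\<^sup>2 = sin x * sin x"
      using sin_squared_eq[of x] by (simp add: power2_eq_square)
    finally have "(1 - ((cos x)\<^sup>2) ^ m) / sin x = sin x * (\<Sum>i<m. ((cos x)\<^sup>2) ^ i)"
      using False by simp
    moreover have "((- 1) ^ m / fact (2 * m + 1) * 1 ^ (2 * m + 1) * cos x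
        - (- 1) ^ m / fact (2 * m + 1) * cos x ^ (2 * m + 1)) / sin x
      = (- 1) ^ m / fact (2 * m + 1) * (cos x * ((1 - ((cos x)\<^sup>2) ^ m) / sin x))"
      by (simp add: power_mult[symmetric] right_diff_distrib diff_divide_distrib
            del: fact_Suc)
    ultimately show ?thesis by (simp del: fact_Suc)
  qed
  ultimately show ?thesis by (simp only:)
qed

text \<open>The inner sum has \<open>m\<close> terms of size at most 1, and the extra factor
  \<open>2 * m + 1\<close> of the odd factorial absorbs it. So
  \<open>series_tail_fact_double\<close> applies to this series too.\<close>

lemma P_tilde_term_le:
  fixes x :: real
  shows "\<bar>(- 1) ^ m / fact (2 * m + 1) * (sin x * cos x * (\<Sum>i<m. ((cos x)\<^sup>2) ^ i))\<bar> \<le> 1 / fact (2 * m)"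
proof -
  have "((cos x)\<^sup>2) ^ i \<le> 1" for i
    by (rule power_le_one) (auto simp: abs_square_le_1)
  then have "(\<Sum>i<m. ((cos x)\<^sup>2) ^ i) \<le> (\<Sum>i<m. 1)"
    by (intro sum_mono)
  then have "\<bar>\<Sum>i<m. ((cos x)\<^sup>2) ^ i\<bar> \<le> real m"
    by (simp add: sum_nonneg)
  then have "\<bar>sin x\<bar> * \<bar>cos x\<bar> * \<bar>\<Sum>i<m. ((cos x)\<^sup>2) ^ i\<bar> \<le> 1 * 1 * real m"
    by (intro mult_mono) auto
  then have "\<bar>(- 1) ^ m / fact (2 * m + 1) * (sin x * cos x * (\<Sum>i<m. ((cos x)\<^sup>2) ^ i))\<bar>
      \<le> real m / fact (2 * m + 1)"
    by (simp add: abs_mult divide_right_mono del: fact_Suc)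
  also have "\<dots> = real m / (2 * real m + 1) * (1 / fact (2 * m))"
    by (simp add: mult_ac add_ac)
  also have "\<dots> \<le> 1 * (1 / fact (2 * m))"
    by (intro mult_right_mono) auto
  finally show ?thesis by simp
qed

section \<open>Numerical enclosures\<close>

lemma inverse_fact_odd_le: "1 / fact (2 * n + 1) \<le> (1 / fact (2 * n) :: real)"
  by (intro divide_left_mono fact_mono) auto

text \<open>The fractions are the partial sums of six terms, and 479001600 is 12!.\<close>

lemma sin_cos_bessel_1_bounds:
  shows "\<bar>sin 1 - 33588829 / 39916800\<bar> \<le> (2 / 479001600 :: real)"
    and "\<bar>cos 1 - 1960649 / 3628800\<bar> \<le> (2 / 479001600 :: real)"
    and "\<bar>bessel_J 0 1 - 11283299 / 14745600\<bar> \<le> 2 / 479001600"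
proof -
  have "\<bar>(- 1) ^ n / fact (2 * n + 1) * 1 ^ (2 * n + 1)\<bar> \<le> (1 / fact (2 * n) :: real)" for n
    using inverse_fact_odd_le[of n] by (simp add: abs_mult del: fact_Suc)
  from series_tail_fact_double[OF sin_paired[of 1] this, of 6]
  show "\<bar>sin 1 - 33588829 / 39916800\<bar> \<le> (2 / 479001600 :: real)"
    by (simp add: eval_nat_numeral fact_numeral)
  have "\<bar>(- 1) ^ n / fact (2 * n) * 1 ^ (2 * n)\<bar> \<le> (1 / fact (2 * n) :: real)" for n
    by simp
  from series_tail_fact_double[OF cos_paired[of 1] this, of 6]
  show "\<bar>cos 1 - 1960649 / 3628800\<bar> \<le> (2 / 479001600 :: real)"
    by (simp add: eval_nat_numeral fact_numeral)
  from series_tail_fact_double[OF bessel_J_0_1_sums bessel_J_0_1_term_le, of 6]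
  show "\<bar>bessel_J 0 1 - 11283299 / 14745600\<bar> \<le> 2 / 479001600"
    by (simp add: eval_nat_numeral fact_numeral)
qed

lemma sqrt_2_sin_bounds: "\<bar>sqrt 2 * sin (sqrt 2 / 2) - 5334193 / 5806080\<bar> \<le> 1 / 10 ^ 6"
proof -
  \<comment> \<open>With this, \<open>sqrt 2 * sin (sqrt 2 / 2)\<close> becomes a series with
    rational terms; 5334193 / 5806080 is the sum of its first five.\<close>
  have sq: "(sqrt 2 / 2) ^ (2 * n + 1) = sqrt 2 / 2 * (1 / 2) ^ n" for n
    by (simp add: power_mult power_divide)
  have r2: "sqrt 2 \<le> 3 / 2"
    by (intro real_le_lsqrt) (auto simp: power2_eq_square)
  have le: "\<bar>(- 1) ^ n / fact (2 * n + 1) * (sqrt 2 / 2) ^ (2 * n + 1)\<bar> \<le> (1 / fact (2 * n) :: real)" for n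
  proof -
    have "sqrt 2 / 2 * (1 / 2) ^ n \<le> 1 * (1 :: real)"
      using r2 by (intro mult_mono power_le_one) auto
    then have "1 / fact (2 * n + 1) * (sqrt 2 / 2 * (1 / 2) ^ n) \<le> 1 / fact (2 * n) * (1 :: real)"
      by (intro mult_mono inverse_fact_odd_le) auto
    then show ?thesis
      unfolding sq by (simp add: abs_mult del: fact_Suc)
  qed
  have "\<bar>sin (sqrt 2 / 2) - sqrt 2 / 2 * (5334193 / 5806080)\<bar> \<le> 2 / 3628800"
    using series_tail_fact_double[OF sin_paired le, of 5] unfolding sq
    by (simp add: eval_nat_numeral fact_numeral mult.commute)
  then have "sqrt 2 * \<bar>sin (sqrt 2 / 2) - sqrt 2 / 2 * (5334193 / 5806080)\<bar> \<le> 3 / 2 * (2 / 3628800)"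
    using r2 by (intro mult_mono) auto
  moreover have "sqrt 2 * \<bar>sin (sqrt 2 / 2) - sqrt 2 / 2 * (5334193 / 5806080)\<bar>
      = \<bar>sqrt 2 * sin (sqrt 2 / 2) - 5334193 / 5806080\<bar>"
    by (simp add: abs_mult_pos' right_diff_distrib flip: mult.assoc)
  ultimately show ?thesis by simp
qed

lemma k_bounds:
  shows "1.49348 \<le> k_a" "k_a \<le> 1.49349" "1.48113 \<le> k_b" "k_b \<le> 1.48114"
proof -
  have "cos 1 - sin 1 < (0 :: real)" "1 - sin 1 > (0 :: real)"
    using sin_cos_bessel_1_bounds(1,2)[unfolded abs_le_iff] by - linarith+
  \<comment> \<open>Denominators are cleared, which leaves inequalities linear in
    \<open>sin 1\<close>, \<open>cos 1\<close> and \<open>bessel_J 0 1\<close>. The denominator of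
    \<open>k_a\<close> is negative, so its inequalities are reversed.\<close>
  then show "1.49348 \<le> k_a" "k_a \<le> 1.49349" "1.48113 \<le> k_b" "k_b \<le> 1.48114"
    unfolding k_a_def k_b_def
      neg_le_divide_eq[OF \<open>cos 1 - sin 1 < 0\<close>] neg_divide_le_eq[OF \<open>cos 1 - sin 1 < 0\<close>]
      pos_le_divide_eq[OF \<open>1 - sin 1 > 0\<close>] pos_divide_le_eq[OF \<open>1 - sin 1 > 0\<close>]
    using sin_cos_bessel_1_bounds[THEN abs_le_D1] sin_cos_bessel_1_bounds[THEN abs_le_D2]
    by simp_all
qed

text \<open>The lower bound is the target that the actual error has to stay below.\<close>

lemma error_constant_bounds:
  shows "9.52 * 10 powi (- 4) \<le> (sqrt 2 * sin (sqrt 2 / 2) - sin 1) * (k_a - k_b)"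
    and "(sqrt 2 * sin (sqrt 2 / 2) - sin 1) * (k_a - k_b) \<le> 9.6 * 10 powi (- 4)"
proof -
  let ?w = "sqrt 2 * sin (sqrt 2 / 2) - sin 1"
  have w: "0.07725 \<le> ?w" "?w \<le> 0.07726"
    using sqrt_2_sin_bounds[THEN abs_le_D1] sqrt_2_sin_bounds[THEN abs_le_D2]
      sin_cos_bessel_1_bounds(1)[THEN abs_le_D1] sin_cos_bessel_1_bounds(1)[THEN abs_le_D2]
    by simp_all
  have k: "0.01234 \<le> k_a - k_b" "k_a - k_b \<le> 0.01236"
    using k_bounds by linarith+
  have "0.07725 * 0.01234 \<le> ?w * (k_a - k_b)" "?w * (k_a - k_b) \<le> 0.07726 * 0.01236"
    using w k by (intro mult_mono; linarith)+
  then show "9.52 * 10 powi (- 4) \<le> ?w * (k_a - k_b)" "?w * (k_a - k_b) \<le> 9.6 * 10 powi (- 4)"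
    by (simp_all add: power_int_def power_divide)
qed

section \<open>The periodic error function\<close>

text \<open>What remains of an antiderivative of \<open>cos (cos x)\<close> minus
  \<open>C1 x\<close> once the terms \<open>bessel_J 0 1 * x\<close> cancel.\<close>

definition error_fun :: "real \<Rightarrow> real" where
  "error_fun x = (\<Sum>m. (- 1) ^ m / fact (2 * m) * cos_osc m x) - k_avg * P_tilde x"

text \<open>The coefficients of the next two polynomials collect the terms \<open>m < 5\<close> of the two series
  in \<open>error_fun\<close>, divided by \<open>sin x * cos x\<close> and written in \<open>y = (cos x)\<^sup>2\<close>.\<close>

definition osc_poly :: "real \<Rightarrow> real" where
  "osc_poly y = - 3847 / 16384 + 83 / 8192 * y - 7 / 30720 * y\<^sup>2 + 1 / 322560 * y ^ 3"

definition P_poly :: "real \<Rightarrow> real" where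
  "P_poly y = - 57527 / 362880 + 2953 / 362880 * y - 71 / 362880 * y\<^sup>2 + 1 / 362880 * y ^ 3"

text \<open>Dropping the terms from \<open>m = 5\<close> on costs at most 2/10! in each series, and
  the second one is weighted by \<open>k_avg\<close>, which is at most 2 in absolute value.\<close>

lemma error_fun_approx:
  "\<bar>error_fun x - sin x * cos x * (osc_poly ((cos x)\<^sup>2) - k_avg * P_poly ((cos x)\<^sup>2))\<bar> \<le> 1 / 10 ^ 5"
proof -
  let ?H = "\<Sum>m. (- 1) ^ m / fact (2 * m) * cos_osc m x"
  have "\<bar>?H - (\<Sum>m<5. (- 1) ^ m / fact (2 * m) * cos_osc m x)\<bar> \<le> 2 / fact (2 * 5)"
    by (intro series_tail_fact_double summable_sums cos_osc_summable cos_osc_term_le)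
  moreover have "(\<Sum>m<5. (- 1) ^ m / fact (2 * m) * cos_osc m x) = sin x * cos x * osc_poly ((cos x)\<^sup>2)"
    by (simp add: eval_nat_numeral fact_numeral osc_poly_def field_simps)
  ultimately have H: "\<bar>?H - sin x * cos x * osc_poly ((cos x)\<^sup>2)\<bar> \<le> 1 / 10 ^ 6"
    by (simp add: fact_numeral)
  have "\<bar>P_tilde x - (\<Sum>m<5. (- 1) ^ m / fact (2 * m + 1) * (sin x * cos x * (\<Sum>i<m. ((cos x)\<^sup>2) ^ i)))\<bar>
      \<le> 2 / fact (2 * 5)"
    by (intro series_tail_fact_double P_tilde_sums P_tilde_term_le)
  moreover have "(\<Sum>m<5. (- 1) ^ m / fact (2 * m + 1) * (sin x * cos x * (\<Sum>i<m. ((cos x)\<^sup>2) ^ i)))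
      = sin x * cos x * P_poly ((cos x)\<^sup>2)"
    by (simp add: eval_nat_numeral fact_numeral P_poly_def field_simps)
  ultimately have P: "\<bar>P_tilde x - sin x * cos x * P_poly ((cos x)\<^sup>2)\<bar> \<le> 1 / 10 ^ 6"
    by (simp add: fact_numeral)
  have k: "\<bar>k_avg\<bar> \<le> 2"
    using k_bounds by (simp add: k_avg_def)
  have "\<bar>k_avg * (P_tilde x - sin x * cos x * P_poly ((cos x)\<^sup>2))\<bar> \<le> 2 * (1 / 10 ^ 6)"
    unfolding abs_mult using k P by (intro mult_mono) auto
  with H have "\<bar>(?H - sin x * cos x * osc_poly ((cos x)\<^sup>2))
      - k_avg * (P_tilde x - sin x * cos x * P_poly ((cos x)\<^sup>2))\<bar> \<le> 1 / 10 ^ 6 + 2 * (1 / 10 ^ 6)"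
    by linarith
  moreover have "(?H - sin x * cos x * osc_poly ((cos x)\<^sup>2))
      - k_avg * (P_tilde x - sin x * cos x * P_poly ((cos x)\<^sup>2))
    = error_fun x - sin x * cos x * (osc_poly ((cos x)\<^sup>2) - k_avg * P_poly ((cos x)\<^sup>2))"
    by (simp add: error_fun_def algebra_simps)
  ultimately show ?thesis by simp
qed

lemma error_poly_near_linear:
  assumes "0 \<le> y" "y \<le> 1"
  shows "\<bar>osc_poly y - k_avg * P_poly y + 0.0019 * (y - 1 / 2)\<bar> \<le> 1 / 10 ^ 4"
proof -
  have y: "0 \<le> y ^ 3" "y ^ 3 \<le> y\<^sup>2" "y\<^sup>2 \<le> y"
    using assms power_decreasing[of 2 3 y] power_decreasing[of 1 2 y] by auto
  have P: "\<bar>P_poly y\<bar> \<le> 1"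
    using assms y unfolding P_poly_def by (intro abs_leI) linarith+
  \<comment> \<open>1.48731 is the value of \<open>k_avg\<close> at the midpoints of the enclosures
    in \<open>k_bounds\<close>.\<close>
  have k: "\<bar>k_avg - 1.48731\<bar> \<le> 1 / 10 ^ 5"
    using k_bounds unfolding k_avg_def by (intro abs_leI) simp_all
  have "osc_poly y - k_avg * P_poly y + 0.0019 * (y - 1 / 2)
      = (osc_poly y - 1.48731 * P_poly y + 0.0019 * (y - 1 / 2)) - (k_avg - 1.48731) * P_poly y"
    by (simp add: algebra_simps)
  also have "\<bar>\<dots>\<bar> \<le> \<bar>osc_poly y - 1.48731 * P_poly y + 0.0019 * (y - 1 / 2)\<bar>
      + \<bar>(k_avg - 1.48731) * P_poly y\<bar>"
    by (rule abs_triangle_ineq4)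
  also have "\<dots> \<le> 9 / 10 ^ 5 + 1 / 10 ^ 5 * 1"
  proof (rule add_mono)
    \<comment> \<open>The slope 0.0019 is, rounded, the decrease of
      \<open>osc_poly y - 1.48731 * P_poly y\<close> from \<open>y = 0\<close> to
      \<open>y = 1\<close>.\<close>
    have "osc_poly y - 1.48731 * P_poly y + 0.0019 * (y - 1 / 2)
        = (1427641 - 3455174 * y + 3054868 * y\<^sup>2 - 48308 * y ^ 3) / 48384000000"
      by (simp add: osc_poly_def P_poly_def algebra_simps diff_divide_distrib)
    \<comment> \<open>4354560 is 9/10^5 times the common denominator. The cubic is bounded linearly
      in \<open>y\<close>, \<open>y\<^sup>2\<close> and \<open>y ^ 3\<close>, using only that these
      decrease in this order and lie between 0 and 1.\<close>
    moreover have "\<bar>1427641 - 3455174 * y + 3054868 * y\<^sup>2 - 48308 * y ^ 3\<bar> \<le> 4354560"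
      using assms y by (intro abs_leI) linarith+
    ultimately show "\<bar>osc_poly y - 1.48731 * P_poly y + 0.0019 * (y - 1 / 2)\<bar> \<le> 9 / 10 ^ 5"
      by (simp only: abs_divide) simp
    show "\<bar>(k_avg - 1.48731) * P_poly y\<bar> \<le> 1 / 10 ^ 5 * 1"
      unfolding abs_mult using k P by (intro mult_mono) auto
  qed
  finally show ?thesis by simp
qed

lemma abs_error_fun_le: "\<bar>error_fun x\<bar> \<le> 4 / 10 ^ 4"
proof -
  define q where "q = osc_poly ((cos x)\<^sup>2) - k_avg * P_poly ((cos x)\<^sup>2)"
  have sc: "\<bar>sin x * cos x\<bar> \<le> 1 / 2"
    using abs_sin_le_one[of "2 * x"] by (simp add: sin_double abs_mult)
  have "sin (4 * x) = 2 * sin (2 * x) * cos (2 * x)"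
    using sin_double[of "2 * x"] by simp
  then have "sin x * cos x * ((cos x)\<^sup>2 - 1 / 2) = sin (4 * x) / 8"
    unfolding sin_double[of x] cos_double_cos by (simp add: algebra_simps)
  then have main: "\<bar>sin x * cos x * ((cos x)\<^sup>2 - 1 / 2)\<bar> \<le> 1 / 8"
    by (simp only: abs_divide) simp
  have "\<bar>q + 0.0019 * ((cos x)\<^sup>2 - 1 / 2)\<bar> \<le> 1 / 10 ^ 4"
    unfolding q_def by (intro error_poly_near_linear) (auto simp: abs_square_le_1)
  then have "\<bar>sin x * cos x * (q + 0.0019 * ((cos x)\<^sup>2 - 1 / 2))\<bar> \<le> 1 / 2 * (1 / 10 ^ 4)"
    unfolding abs_mult[of "sin x * cos x"] using sc by (intro mult_mono) auto
  moreover have "sin x * cos x * q = sin x * cos x * (q + 0.0019 * ((cos x)\<^sup>2 - 1 / 2))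
      - 0.0019 * (sin x * cos x * ((cos x)\<^sup>2 - 1 / 2))"
    by (simp add: algebra_simps)
  \<comment> \<open>Numerically, 0.0019 / 8 + 0.00005 = 0.0002875.\<close>
  moreover have "\<bar>b - 0.0019 * c\<bar> \<le> 3 / 10 ^ 4"
    if "\<bar>b\<bar> \<le> 1 / 2 * (1 / 10 ^ 4)" "\<bar>c\<bar> \<le> 1 / 8" for b c :: real
    using that by (simp add: abs_if split: if_splits)
  ultimately have "\<bar>sin x * cos x * q\<bar> \<le> 3 / 10 ^ 4"
    using main by presburger
  then show ?thesis
    using error_fun_approx[of x, folded q_def] by (simp add: abs_if split: if_splits)
qed

theorem mainTheorem1:
  fixes l u :: real
  assumes "l \<le> u"
  shows "\<bar>integral {l..u} (\<lambda>x. cos (cos x)) - (C1 u - C1 l)\<bar>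
           \<le> (sqrt 2 * sin (sqrt 2 / 2) - sin 1) * (k_a - k_b)
         \<and> (sqrt 2 * sin (sqrt 2 / 2) - sin 1) * (k_a - k_b) \<le> 9.6 * 10 powi (- 4)"
proof
  have "integral {l..u} (\<lambda>x. cos (cos x)) - (C1 u - C1 l) = error_fun u - error_fun l"
    by (simp add: integral_cos_cos_eq[OF assms] C1_def error_fun_def algebra_simps)
  \<comment> \<open>Each endpoint contributes at most 4/10^4, and the total stays below the lower
    bound 9.52/10^4 for the error constant.\<close>
  then have "\<bar>integral {l..u} (\<lambda>x. cos (cos x)) - (C1 u - C1 l)\<bar> \<le> 8 / 10 ^ 4"
    using abs_error_fun_le[of u] abs_error_fun_le[of l] unfolding abs_le_iff by linarith
  also have "\<dots> \<le> 9.52 * 10 powi (- 4)"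
    by (simp add: power_int_def power_divide)
  finally show "\<bar>integral {l..u} (\<lambda>x. cos (cos x)) - (C1 u - C1 l)\<bar>
      \<le> (sqrt 2 * sin (sqrt 2 / 2) - sin 1) * (k_a - k_b)"
    using error_constant_bounds(1) by linarith
qed (rule error_constant_bounds)

end
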